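(* Let $X$ be a topological space and let $S\subseteq\mathcal{O}(X)$ be a $T_1$ $\cup$-subbasis of $X$ every member of which is relatively compact in $X$. Regard $S$ as a $\vee$-semilattice ordered by inclusion. Then the map $$x\mapsto S_x=\{s\in S: x\in s\}$$ is a homeomorphism from $X$ onto the spectrum $\widehat{S}$.
   Context: A $\vee$-semilattice is a non-empty poset in which any two elements $p,q$ have a supremum $p\vee q$. A grill in a $\vee$-semilattice $S$ is a subset $G\subseteq S$ such that $p\vee q\geq g\in G$ implies $p\in G$ or $q\in G$ (equivalently, $G$ is an up-set and $p\vee q\in G$ implies $p\in G$ or $q\in G$). The spectrum $\widehat{S}$ is the set of all proper minimal non-empty grills of $S$, i.e. grills $G$ with $\emptyset\neq G\neq S$ such that no non-empty grill is strictly contained in $G$. It carries the topology generated by the subbasis $(\widehat{S}_g)_{g\in S}$, where $\widehat{S}_g=\{G\in\widehat{S}:g\in G\}$. $\mathcal{O}(X)$ denotes the collection of open subsets of $X$. A family $\mathcal{P}$ of subsets of $X$ is $T_1$ if for all $a,b\subseteq X$, each of which is a singleton or empty, $a\cap b=\emptyset$ implies that there is $p\in\mathcal{P}$ with $a\subseteq p$ and $b\cap p=\emptyset$. A set $R\subseteq X$ is relatively compact if every open cover of $X$ has a finite subfamily covering $R$. A $\cup$-subbasis of $X$ is a subbasis $S\subseteq\mathcal{O}(X)$ (non-empty) for the topology which is closed under pairwise unions. *)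

theory Defs
  imports "HOL-Analysis.Analysis" "HOL-Algebra.Lattice"
begin

section \<open>Grills and the spectrum of a join-semilattice\<close>

text \<open>Posets are HOL-Algebra order records \<open>L\<close>; the notions below are meant for
  \<open>L\<close> satisfying \<open>upper_semilattice L\<close> with nonempty carrier.\<close>

definition grill :: "('a, 'b) gorder_scheme \<Rightarrow> 'a set \<Rightarrow> bool" where
  "grill L G \<longleftrightarrow> G \<subseteq> carrier L \<and>
     (\<forall>p\<in>carrier L. \<forall>q\<in>carrier L. \<forall>g\<in>G. g \<sqsubseteq>\<^bsub>L\<^esub> p \<squnion>\<^bsub>L\<^esub> q \<longrightarrow> p \<in> G \<or> q \<in> G)"

definition spectrum :: "('a, 'b) gorder_scheme \<Rightarrow> 'a set set" where
  "spectrum L = {G. grill L G \<and> G \<noteq> {} \<and> G \<noteq> carrier L \<and>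
     \<not> (\<exists>H. grill L H \<and> H \<noteq> {} \<and> H \<subset> G)}"

section \<open>Subbases\<close>

text \<open>The coarsest topology on the set \<open>M\<close> in which the members of \<open>\<B>\<close>, cut down
  to \<open>M\<close>, are open. The empty intersection counts as \<open>M\<close>, so \<open>\<B>\<close> need not cover \<open>M\<close>.\<close>

definition topology_subbase :: "'a set \<Rightarrow> 'a set set \<Rightarrow> 'a topology" where
  "topology_subbase M \<B> =
     topology (arbitrary union_of (finite intersection_of (\<lambda>b. b \<in> \<B>) relative_to M))"

definition spectrum_topology :: "('a, 'b) gorder_scheme \<Rightarrow> 'a set topology" where
  "spectrum_topology L =
     topology_subbase (spectrum L) ((\<lambda>g. {G \<in> spectrum L. g \<in> G}) ` carrier L)"

definition union_subbasis :: "'a topology \<Rightarrow> 'a set set \<Rightarrow> bool" where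
  "union_subbasis X S \<longleftrightarrow> S \<noteq> {} \<and> (\<forall>s\<in>S. openin X s) \<and>
     X = topology_subbase (topspace X) S \<and> (\<forall>s\<in>S. \<forall>t\<in>S. s \<union> t \<in> S)"

section \<open>\<open>T\<^sub>1\<close> families and relative compactness\<close>

definition T1_family :: "'a set \<Rightarrow> 'a set set \<Rightarrow> bool" where
  "T1_family M P \<longleftrightarrow> P \<subseteq> Pow M \<and>
     (\<forall>a b. a \<subseteq> M \<and> b \<subseteq> M \<and> (a = {} \<or> is_singleton a) \<and> (b = {} \<or> is_singleton b) \<and> a \<inter> b = {}
        \<longrightarrow> (\<exists>p\<in>P. a \<subseteq> p \<and> b \<inter> p = {}))"

text \<open>Relative compactness refers to open covers of the whole space; without separation axioms
  this is weaker than compactness of the closure.\<close>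

definition relatively_compact_in :: "'a topology \<Rightarrow> 'a set \<Rightarrow> bool" where
  "relatively_compact_in X R \<longleftrightarrow> R \<subseteq> topspace X \<and>
     (\<forall>\<U>. (\<forall>u\<in>\<U>. openin X u) \<and> \<Union>\<U> = topspace X
        \<longrightarrow> (\<exists>\<F>. finite \<F> \<and> \<F> \<subseteq> \<U> \<and> R \<subseteq> \<Union>\<F>))"

section \<open>Families of sets as posets\<close>

abbreviation inclusion_order :: "'a set set \<Rightarrow> 'a set gorder" where
  "inclusion_order S \<equiv> \<lparr>carrier = S, eq = (=), le = (\<subseteq>)\<rparr>"

lemma least_Upper_inclusion_order:
  assumes "\<And>s t. s \<in> S \<Longrightarrow> t \<in> S \<Longrightarrow> s \<union> t \<in> S" "s \<in> S" "t \<in> S"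
  shows "least (inclusion_order S) u (Upper (inclusion_order S) {s, t}) \<longleftrightarrow> u = s \<union> t"
proof
  assume "least (inclusion_order S) u (Upper (inclusion_order S) {s, t})"
  then have "s \<subseteq> u" "t \<subseteq> u" "\<And>v. v \<in> S \<Longrightarrow> s \<subseteq> v \<Longrightarrow> t \<subseteq> v \<Longrightarrow> u \<subseteq> v"
    using assms(2,3) by (simp_all add: least_def Upper_def)
  from this(1,2) this(3)[OF assms(1)[OF assms(2,3)]] show "u = s \<union> t"
    by blast
next
  assume "u = s \<union> t"
  with assms(2,3) assms(1)[OF assms(2,3)]
  show "least (inclusion_order S) u (Upper (inclusion_order S) {s, t})"
    by (simp add: least_def Upper_def)
qed

lemma upper_semilattice_inclusion_order:
  assumes "\<And>s t. s \<in> S \<Longrightarrow> t \<in> S \<Longrightarrow> s \<union> t \<in> S"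
  shows "upper_semilattice (inclusion_order S)"
proof -
  have "partial_order (inclusion_order S)"
    by standard auto
  moreover have "\<exists>u. least (inclusion_order S) u (Upper (inclusion_order S) {s, t})"
    if "s \<in> S" "t \<in> S" for s t
    using least_Upper_inclusion_order[OF assms that] by blast
  ultimately show ?thesis
    by (simp add: upper_semilattice_def upper_semilattice_axioms_def)
qed

lemma join_inclusion_order:
  assumes "\<And>s t. s \<in> S \<Longrightarrow> t \<in> S \<Longrightarrow> s \<union> t \<in> S" "s \<in> S" "t \<in> S"
  shows "s \<squnion>\<^bsub>inclusion_order S\<^esub> t = s \<union> t"
  unfolding join_def sup_def using least_Upper_inclusion_order[OF assms] by simp

end

theory Submission
  imports Defs
begin

text \<open>Call \<open>S\<^sub>x\<close> the set of members of \<open>S\<close> containing \<open>x\<close>. Relative compactness shows that every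
  proper non-empty grill \<open>G\<close> contains some \<open>S\<^sub>y\<close>: otherwise every point of \<open>X\<close> lies in a member
  of \<open>S - G\<close>, so a given element of \<open>G\<close> is below a finite union of members of \<open>S - G\<close>, contrary to
  the grill property. Since \<open>S\<close> is \<open>T\<^sub>1\<close>, distinct \<open>S\<^sub>x\<close> are incomparable, so the minimal grills
  are exactly the \<open>S\<^sub>x\<close>; the two subbases then correspond.\<close>

lemma topspace_topology_subbase [simp]: "topspace (topology_subbase M \<B>) = M"
  by (simp add: topology_subbase_def)

lemma openin_topology_subbase:
  assumes "b \<in> \<B>"
  shows "openin (topology_subbase M \<B>) (M \<inter> b)"
  unfolding topology_subbase_def openin_subbase using assms
  by (intro arbitrary_union_of_inc relative_to_inc finite_intersection_of_inc)

lemma continuous_map_into_topology_subbase_iff: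
  "continuous_map X (topology_subbase M \<B>) f \<longleftrightarrow>
     f \<in> topspace X \<rightarrow> M \<and> (\<forall>b\<in>\<B>. openin X {x \<in> topspace X. f x \<in> b})"
  using continuous_map_into_topology_subbase_eq[OF topology_subbase_def, of X M \<B> f]
  by auto

text \<open>Continuity need only be tested on subbasic sets, and injectivity makes \<open>b\<close>
  exactly the preimage of its image under \<open>f\<close>.\<close>

lemma homeomorphic_map_topology_subbase:
  assumes bij: "bij_betw f M N" and sub: "\<B> \<subseteq> Pow M"
  shows "homeomorphic_map (topology_subbase M \<B>) (topology_subbase N ((`) f ` \<B>)) f"
proof -
  let ?g = "inv_into M f"
  have inj: "inj_on f M" and im: "f ` M = N"
    using bij by (auto simp: bij_betw_def)
  have preimage: "{x \<in> M. f x \<in> f ` b} = M \<inter> b" if "b \<in> \<B>" for b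
    using that sub inj by (auto dest: inj_onD)
  have image: "{y \<in> N. ?g y \<in> b} = N \<inter> f ` b" if "b \<in> \<B>" for b
    using that sub inj im by (force simp: inv_into_f_f f_inv_into_f)
  have "continuous_map (topology_subbase M \<B>) (topology_subbase N ((`) f ` \<B>)) f"
    using im preimage by (auto simp: continuous_map_into_topology_subbase_iff openin_topology_subbase)
  moreover have "continuous_map (topology_subbase N ((`) f ` \<B>)) (topology_subbase M \<B>) ?g"
    using im image
    by (auto simp: continuous_map_into_topology_subbase_iff openin_topology_subbase inv_into_into)
  ultimately have "homeomorphic_maps (topology_subbase M \<B>) (topology_subbase N ((`) f ` \<B>)) f ?g"
    using inj im by (auto simp: homeomorphic_maps_def f_inv_into_f)
  then show ?thesis
    by (rule homeomorphic_maps_imp_map)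
qed

lemma grill_inclusion_order_iff:
  assumes "\<forall>s\<in>S. \<forall>t\<in>S. s \<union> t \<in> S"
  shows "grill (inclusion_order S) G \<longleftrightarrow>
    G \<subseteq> S \<and> (\<forall>p\<in>S. \<forall>q\<in>S. \<forall>g\<in>G. g \<subseteq> p \<union> q \<longrightarrow> p \<in> G \<or> q \<in> G)"
  unfolding grill_def using join_inclusion_order[of S] assms by simp

text \<open>Iterates the binary grill property. The case \<open>F = {}\<close> would fail for
  \<open>g = {}\<close>.\<close>

lemma grill_finite_Union:
  assumes un: "\<forall>s\<in>S. \<forall>t\<in>S. s \<union> t \<in> S"
    and G: "grill (inclusion_order S) G"
    and "finite F" "F \<noteq> {}" "F \<subseteq> S" "g \<in> G" "g \<subseteq> \<Union>F"
  shows "\<exists>s\<in>F. s \<in> G"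
proof -
  have prime: "p \<in> G \<or> q \<in> G" if "p \<in> S" "q \<in> S" "h \<in> G" "h \<subseteq> p \<union> q" for p q h
    using G that unfolding grill_inclusion_order_iff[OF un] by blast
  \<comment> \<open>Membership in \<open>S\<close> is carried along because \<open>prime\<close>
    applies only to elements of \<open>S\<close>.\<close>
  have "\<Union>F \<in> S \<and> (\<Union>F \<in> G \<longrightarrow> (\<exists>s\<in>F. s \<in> G))"
    using \<open>finite F\<close> \<open>F \<noteq> {}\<close> \<open>F \<subseteq> S\<close>
  proof (induction F rule: finite_ne_induct)
    case (insert s F)
    then show ?case
      using un prime[of s "\<Union>F" "s \<union> \<Union>F"] by auto
  qed simp
  then show ?thesis
    \<comment> \<open>With \<open>p = q\<close> the grill property says that \<open>G\<close> is an
      up-set.\<close>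
    using prime[of "\<Union>F" "\<Union>F" g] assms(6,7) by auto
qed

theorem theorem2p6:
  fixes X :: "'a topology" and S :: "'a set set"
  assumes "union_subbasis X S"
    and "T1_family (topspace X) S"
    and "\<And>s. s \<in> S \<Longrightarrow> relatively_compact_in X s"
  shows "homeomorphic_map X (spectrum_topology (inclusion_order S)) (\<lambda>x. {s \<in> S. x \<in> s})"
proof -
  let ?M = "topspace X" and ?L = "inclusion_order S" and ?f = "\<lambda>x. {s \<in> S. x \<in> s}"
  have un: "\<forall>s\<in>S. \<forall>t\<in>S. s \<union> t \<in> S" and opn: "\<And>s. s \<in> S \<Longrightarrow> openin X s"
    and X: "X = topology_subbase ?M S"
    using assms(1) unfolding union_subbasis_def by blast+
  have sub: "S \<subseteq> Pow ?M"
    using assms(2) by (simp add: T1_family_def)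
  note T1 = assms(2)[unfolded T1_family_def, THEN conjunct2, rule_format]
  \<comment> \<open>Empty \<open>b\<close> yields a member containing \<open>x\<close>, empty
    \<open>a\<close> a member avoiding \<open>x\<close>.\<close>
  have ne: "?f x \<noteq> {}" and proper: "?f x \<noteq> S" if "x \<in> ?M" for x
    using T1[of "{x}" "{}"] T1[of "{}" "{x}"] that by (auto simp: is_singleton_def)
  have eqI: "x = y" if "x \<in> ?M" "y \<in> ?M" "?f x \<subseteq> ?f y" for x y
    using T1[of "{x}" "{y}"] that by (auto simp: is_singleton_def)
  have grill_f: "grill ?L (?f x)" for x
    by (auto simp: grill_inclusion_order_iff[OF un])
  have above: "\<exists>y\<in>?M. ?f y \<subseteq> G" if G: "grill ?L G" "G \<noteq> {}" "G \<noteq> S" for G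
  proof (rule ccontr)
    assume "\<not> ?thesis"
    \<comment> \<open>A witness that \<open>?f y\<close> is not contained in \<open>G\<close> is a
      member of \<open>S - G\<close> around \<open>y\<close>.\<close>
    then have "?M \<subseteq> \<Union>(S - G)"
      by blast
    then have cover: "\<Union>(S - G) = ?M"
      using sub by blast
    obtain h where h: "h \<in> G" "h \<in> S"
      using G by (auto simp: grill_inclusion_order_iff[OF un])
    have "\<exists>F. finite F \<and> F \<subseteq> S - G \<and> h \<subseteq> \<Union>F"
      using assms(3)[OF h(2)] cover opn unfolding relatively_compact_in_def by auto
    then obtain F where F: "finite F" "F \<subseteq> S - G" "h \<subseteq> \<Union>F"
      by blast
    obtain s where s: "s \<in> S - G"
      using G by (auto simp: grill_inclusion_order_iff[OF un])
    \<comment> \<open>Adding \<open>s\<close> keeps the cover non-empty when \<open>h = {}\<close>.\<close>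
    then show False
      using grill_finite_Union[OF un G(1), of "insert s F" h] F h by auto
  qed
  have spectrum: "spectrum ?L = ?f ` ?M"
  proof (intro subset_antisym subsetI)
    fix G assume G: "G \<in> spectrum ?L"
    then obtain y where "y \<in> ?M" "?f y \<subseteq> G"
      using above[of G] by (auto simp: spectrum_def)
    \<comment> \<open>\<open>?f y\<close> is a non-empty grill inside \<open>G\<close>, so
      minimality of \<open>G\<close> forces equality.\<close>
    then show "G \<in> ?f ` ?M"
      using G grill_f[of y] ne[of y] unfolding spectrum_def by blast
  next
    fix G assume "G \<in> ?f ` ?M"
    then obtain x where x: "x \<in> ?M" "G = ?f x"
      by blast
    have False if H: "grill ?L H" "H \<noteq> {}" "H \<subset> ?f x" for H
    proof -
      \<comment> \<open>\<open>H\<close> is proper, being strictly below \<open>?f x\<close>. Then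
        \<open>eqI\<close> gives \<open>y = x\<close>, so \<open>H\<close> contains all of
        \<open>?f x\<close>.\<close>
      obtain y where "y \<in> ?M" "?f y \<subseteq> H"
        using above[of H] H by blast
      then show False
        using eqI[of y x] x H by blast
    qed
    then show "G \<in> spectrum ?L"
      using x grill_f[of x] ne[of x] proper[of x] by (auto simp: spectrum_def)
  qed
  have "bij_betw ?f ?M (spectrum ?L)"
    unfolding bij_betw_def spectrum using eqI by (intro conjI inj_onI) auto
  then have "homeomorphic_map (topology_subbase ?M S) (topology_subbase (spectrum ?L) ((`) ?f ` S)) ?f"
    using sub by (rule homeomorphic_map_topology_subbase)
  \<comment> \<open>Every spectrum point is some \<open>?f x\<close>, and \<open>s\<close> belongs
    to it iff \<open>x \<in> s\<close>.\<close>
  moreover have "{G \<in> spectrum ?L. s \<in> G} = ?f ` s" if "s \<in> S" for s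
    unfolding spectrum using that sub by auto
  then have "spectrum_topology ?L = topology_subbase (spectrum ?L) ((`) ?f ` S)"
    by (simp add: spectrum_topology_def cong: image_cong_simp)
  ultimately show ?thesis
    using X by simp
qed

end
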